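(* Let $n\in\mathbb{N}$, $\pi\in S_n'$ and $x,y\in[n]$. If $T_\pi(x)\ge_D T_\pi(y)$, then $x\ge y$.
   Context: A "permutation" may be any finite sequence of distinct integers. West's stack-sorting map $s$: read the input left to right with an initially empty stack; repeatedly, if the input is nonempty and either the stack is empty or the top of the stack is greater than the next input entry, push the next entry; otherwise pop the top of the stack and append it to the output; stop when input and stack are empty. $\operatorname{sc}(\pi)$ is the least $k\ge0$ with $s^k(\pi)$ increasing. $S_n'$ is the set of permutations of $\{0,1,\dots,n\}$ whose last entry is $0$. For $\pi\in S_n'$ and $1\le i\le\operatorname{sc}(\pi)$ let $\sigma=s^{i-1}(\pi)$. Let $c_{\pi,i,1}$ be the maximum of the entries of $\sigma$ strictly left of $0$; for $j\ge2$, as long as some entry of $\sigma$ lies strictly between $c_{\pi,i,j-1}$ and $0$, let $c_{\pi,i,j}$ be the maximum of those entries; otherwise stop. This gives $C_{\pi,i}=(c_{\pi,i,1},\dots,c_{\pi,i,|C_{\pi,i}|})$. Blocks: $b_{\pi,i,1}$ is the contiguous subsequence of $\sigma$ strictly before $c_{\pi,i,1}$, and $b_{\pi,i,j}$ ($j\ge2$) the contiguous subsequence strictly between $c_{\pi,i,j-1}$ and $c_{\pi,i,j}$. Every $x\in[n]$ equals $c_{\pi,i,j}$ for a unique pair $(i,j)$; set $\operatorname{col}_\pi(x)=i$, $\operatorname{colpos}_\pi(x)=j$. If $\operatorname{col}_\pi(x)>1$, there is a unique $j$ with $x=\max(b_{\pi,\operatorname{col}_\pi(x)-1,j})$, and $\operatorname{leftof}_\pi(x):=c_{\pi,\operatorname{col}_\pi(x)-1,j}$.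 Recursively $\operatorname{row}_\pi(x)=\operatorname{colpos}_\pi(x)$ if $\operatorname{col}_\pi(x)=1$, and $\operatorname{row}_\pi(x)=\operatorname{row}_\pi(\operatorname{leftof}_\pi(x))$ otherwise. The composition $\alpha_\pi=(|\{x\in[n]:\operatorname{row}_\pi(x)=j\}|)_{j=1}^{|C_{\pi,1}|}$ is a composition of $n$. For a composition $\alpha=(\alpha_1,\dots,\alpha_k)$, $D(\alpha)=\{(i,j)\in\mathbb{N}^2: 1\le j\le k,\ i\le\alpha_j\}$, partially ordered by $(a,b)\ge_D(c,d)$ iff $a\le c$ and $b\le d$. The stack-sorting tableau is $T_\pi:[n]\to D(\alpha_\pi)$, $T_\pi(x)=(\operatorname{col}_\pi(x),\operatorname{row}_\pi(x))$. *)

theory Defs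
  imports "HOL-Combinatorics.Multiset_Permutations"
begin

(* First argument: remaining input; second: the stack, top first.
   The result is the output produced from this state on. *)
fun stack_run :: "'a::linorder list \<Rightarrow> 'a list \<Rightarrow> 'a list" where
  "stack_run [] [] = []"
| "stack_run [] (t # st) = t # stack_run [] st"
| "stack_run (x # xs) [] = stack_run xs [x]"
| "stack_run (x # xs) (t # st) =
     (if t > x then stack_run xs (x # t # st) else t # stack_run (x # xs) st)"

definition stack_sort :: "'a::linorder list \<Rightarrow> 'a list" where
  "stack_sort \<pi> = stack_run \<pi> []"

definition sc :: "'a::linorder list \<Rightarrow> nat" where
  "sc \<pi> = (LEAST k. sorted_wrt (<) ((stack_sort ^^ k) \<pi>))"

definition S' :: "nat \<Rightarrow> nat list set" where
  "S' n = {\<pi> \<in> permutations_of_set {0..n}. last \<pi> = 0}"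

(* The maximum of the list, then the maximum of the part after it, and so on. *)
function suffix_maxima :: "'a::linorder list \<Rightarrow> 'a list" where
  "suffix_maxima xs = (if xs = [] then [] else
     Max (set xs) # suffix_maxima (tl (dropWhile (\<lambda>y. y \<noteq> Max (set xs)) xs)))"
  by pat_completeness auto
termination
proof (relation "measure length")
  fix xs :: "'a list"
  assume "xs \<noteq> []"
  then show "(tl (dropWhile (\<lambda>y. y \<noteq> Max (set xs)) xs), xs) \<in> measure length"
    using length_dropWhile_le[of "\<lambda>y. y \<noteq> Max (set xs)" xs]
    by (cases xs) (auto simp: less_Suc_eq_le)
qed simp

declare suffix_maxima.simps [simp del]

(* All indices i and j below are 1-based, with i ranging over {1..sc \<pi>}. *)

definition sigma :: "nat list \<Rightarrow> nat \<Rightarrow> nat list" where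
  "sigma \<pi> i = (stack_sort ^^ (i - 1)) \<pi>"

definition C_seq :: "nat list \<Rightarrow> nat \<Rightarrow> nat list" where
  "C_seq \<pi> i = suffix_maxima (takeWhile (\<lambda>y. y \<noteq> 0) (sigma \<pi> i))"

definition c_entry :: "nat list \<Rightarrow> nat \<Rightarrow> nat \<Rightarrow> nat" where
  "c_entry \<pi> i j = C_seq \<pi> i ! (j - 1)"

definition block :: "nat list \<Rightarrow> nat \<Rightarrow> nat \<Rightarrow> nat list" where
  "block \<pi> i j =
     (if j = 1 then takeWhile (\<lambda>y. y \<noteq> c_entry \<pi> i 1) (sigma \<pi> i)
      else takeWhile (\<lambda>y. y \<noteq> c_entry \<pi> i j)
             (tl (dropWhile (\<lambda>y. y \<noteq> c_entry \<pi> i (j - 1)) (sigma \<pi> i))))"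

definition col_colpos :: "nat list \<Rightarrow> nat \<Rightarrow> nat \<times> nat" where
  "col_colpos \<pi> x =
     (THE (i, j). i \<in> {1..sc \<pi>} \<and> j \<in> {1..length (C_seq \<pi> i)} \<and> x = c_entry \<pi> i j)"

definition col :: "nat list \<Rightarrow> nat \<Rightarrow> nat" where
  "col \<pi> x = fst (col_colpos \<pi> x)"

definition colpos :: "nat list \<Rightarrow> nat \<Rightarrow> nat" where
  "colpos \<pi> x = snd (col_colpos \<pi> x)"

definition leftof :: "nat list \<Rightarrow> nat \<Rightarrow> nat" where
  "leftof \<pi> x =
     c_entry \<pi> (col \<pi> x - 1)
       (THE j. j \<in> {1..length (C_seq \<pi> (col \<pi> x - 1))} \<and>
               block \<pi> (col \<pi> x - 1) j \<noteq> [] \<and>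
               x = Max (set (block \<pi> (col \<pi> x - 1) j)))"

(* The recursion decreases col on entries of [n]; a partial_function gives the
   recursion equation without that argument. *)
partial_function (tailrec) row :: "nat list \<Rightarrow> nat \<Rightarrow> nat" where
  "row \<pi> x = (if col \<pi> x = 1 then colpos \<pi> x else row \<pi> (leftof \<pi> x))"

(* For \<pi> in S' n the entries of [n] are those of \<pi> other than 0. *)
definition composition :: "nat list \<Rightarrow> nat list" where
  "composition \<pi> = map (\<lambda>j. card {x \<in> set \<pi> - {0}. row \<pi> x = j}) [1..<Suc (length (C_seq \<pi> 1))]"

definition diagram :: "nat list \<Rightarrow> (nat \<times> nat) set" where
  "diagram \<alpha> = {(i, j). 1 \<le> j \<and> j \<le> length \<alpha> \<and> 1 \<le> i \<and> i \<le> \<alpha> ! (j - 1)}"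

(* Stated on all pairs; the order of each diagram is its restriction. *)
definition diagram_ge :: "nat \<times> nat \<Rightarrow> nat \<times> nat \<Rightarrow> bool" (infix "\<ge>\<^sub>D" 50) where
  "p \<ge>\<^sub>D q \<longleftrightarrow> fst p \<le> fst q \<and> snd p \<le> snd q"

(* On [n] the values lie in diagram (composition \<pi>). *)
definition tableau :: "nat list \<Rightarrow> nat \<Rightarrow> nat \<times> nat" where
  "tableau \<pi> x = (col \<pi> x, row \<pi> x)"

end

theory Submission
  imports Defs
begin

text \<open>
  Write the part of an iterate left of 0 as \<open>b\<^sub>1 c\<^sub>1 b\<^sub>2 c\<^sub>2 \<dots> b\<^sub>k c\<^sub>k\<close>, where the \<open>c\<^sub>j\<close> are its
  suffix maxima. Sorting leaves \<open>s b\<^sub>1 s b\<^sub>2 \<dots> s b\<^sub>k\<close> left of 0, and each \<open>s b\<close> ends with its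
  maximum. So the suffix maxima of the next iterate are maxima of blocks, a block lies below the
  \<open>c\<^sub>j\<close> that follows it, and a larger suffix maximum comes from an earlier block, hence lies below
  a larger \<open>c\<^sub>j\<close>. Consequently \<open>leftof\<close> increases values and is strictly increasing on
  each column, so rows are strictly decreasing in the value on each column. Applying
  \<open>leftof\<close> to the entry \<open>y\<close> until it reaches the column of \<open>x\<close> reduces the
  theorem to two entries of the same column.
\<close>

section \<open>The stack-sorting map\<close>

lemma mset_stack_run: "mset (stack_run xs st) = mset xs + mset st"
  by (induction xs st rule: stack_run.induct) auto

lemma mset_stack_sort [simp]: "mset (stack_sort xs) = mset xs"
  by (simp add: stack_sort_def mset_stack_run)

lemma set_stack_sort [simp]: "set (stack_sort xs) = set xs"
  by (metis mset_stack_sort set_mset_mset)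

lemma distinct_stack_sort [simp]: "distinct (stack_sort xs) = distinct xs"
  by (metis mset_stack_sort mset_eq_imp_distinct_iff)

lemma length_stack_sort [simp]: "length (stack_sort xs) = length xs"
  by (metis mset_stack_sort size_mset)

text \<open>Entries of \<open>b\<close> are too small to pop anything in \<open>us\<close>, so they
  are processed as if the stack ended at \<open>st\<close>. The arrival of \<open>c\<close> then
  pops whatever is left above \<open>us\<close>, just as the end of the input \<open>b\<close>
  would.\<close>

lemma stack_run_append_Cons:
  assumes "\<forall>z \<in> set b \<union> set st. z < c" "\<forall>z \<in> set b. \<forall>t \<in> set us. z < t"
  shows "stack_run (b @ c # r) (st @ us) = stack_run b st @ stack_run (c # r) us"
  using assms
proof (induction b st rule: stack_run.induct)
  case (3 x xs)
  then show ?case by (cases us) auto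
qed auto

lemma stack_run_push:
  "\<forall>t \<in> set us. c < t \<Longrightarrow> stack_run (c # r) us = stack_run r (c # us)"
  by (cases us) auto

text \<open>No smaller input entry can pop \<open>m\<close>, so it stays at the bottom and leaves
  last.\<close>

lemma stack_run_large_bottom:
  "\<forall>z \<in> set xs \<union> set st. z < m \<Longrightarrow> stack_run xs (st @ [m]) = stack_run xs st @ [m]"
  by (induction xs st rule: stack_run.induct) auto

text \<open>West's recursive description of the map: \<open>m\<close> empties the stack on arrival
  and then lies beneath everything while \<open>r\<close> is sorted above it.\<close>

lemma stack_sort_around_max:
  assumes "\<forall>z \<in> set l \<union> set r. z < m"
  shows "stack_sort (l @ m # r) = stack_sort l @ stack_sort r @ [m]"
  using stack_run_append_Cons[of l "[]" m "[]" r] stack_run_large_bottom[of r "[]" m] assms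
  by (simp add: stack_sort_def)

lemma split_at_Max:
  assumes "distinct xs" "xs \<noteq> []"
  obtains l r where "xs = l @ Max (set xs) # r" "\<forall>z \<in> set l \<union> set r. z < Max (set xs)"
proof -
  have "Max (set xs) \<in> set xs"
    using assms by simp
  then obtain l r where lr: "xs = l @ Max (set xs) # r"
    by (meson split_list)
  have "z < Max (set xs)" if "z \<in> set l \<union> set r" for z
  proof -
    have "distinct (l @ Max (set xs) # r)"
      using assms(1) lr by metis
    then have "z \<noteq> Max (set xs)"
      using that by auto
    moreover have "z \<in> set xs"
      using that by (subst lr) auto
    ultimately show ?thesis
      by (simp add: order_less_le)
  qed
  then show thesis
    using lr that by blast
qed

lemma stack_sort_ends_with_Max:
  assumes "distinct xs" "xs \<noteq> []"
  obtains ys where "stack_sort xs = ys @ [Max (set xs)]"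
proof -
  obtain l r where "xs = l @ Max (set xs) # r" "\<forall>z \<in> set l \<union> set r. z < Max (set xs)"
    using split_at_Max assms by blast
  then have "stack_sort xs = (stack_sort l @ stack_sort r) @ [Max (set xs)]"
    using stack_sort_around_max[of l r "Max (set xs)"] by (metis append_assoc)
  then show thesis by (rule that)
qed

section \<open>Termination of iterated sorting\<close>

lemma set_stack_sort_iter [simp]: "set ((stack_sort ^^ k) xs) = set xs"
  by (induction k) auto

lemma distinct_stack_sort_iter [simp]: "distinct ((stack_sort ^^ k) xs) = distinct xs"
  by (induction k) auto

lemma stack_sort_iter_snoc:
  assumes "\<forall>z \<in> set xs. z < m"
  shows "(stack_sort ^^ k) (xs @ [m]) = (stack_sort ^^ k) xs @ [m]"
proof (induction k)
  case (Suc k)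
  have "stack_sort ((stack_sort ^^ k) xs @ [m]) = stack_sort ((stack_sort ^^ k) xs) @ [m]"
    using stack_sort_around_max[of "(stack_sort ^^ k) xs" "[]" m] assms
    by (simp add: stack_sort_def)
  with Suc show ?case by simp
qed simp

text \<open>One pass moves the maximum to the end, where it stays for good; the remaining passes
  sort a list shorter by one. This provides the witness that makes the \<open>LEAST\<close> in
  \<open>sc\<close> meaningful.\<close>

lemma stack_sort_iter_length_sorted:
  "distinct xs \<Longrightarrow> sorted_wrt (<) ((stack_sort ^^ length xs) xs)"
proof (induction "length xs" arbitrary: xs)
  case (Suc k)
  then have ne: "xs \<noteq> []" by auto
  obtain ys where ys: "stack_sort xs = ys @ [Max (set xs)]"
    using stack_sort_ends_with_Max Suc.prems ne by blast
  have d: "distinct (ys @ [Max (set xs)])"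
    using Suc.prems ys by (metis distinct_stack_sort)
  have len: "length ys = k"
    using Suc.hyps(2) ys by (metis length_stack_sort length_append_singleton nat.inject)
  have sub: "set ys \<subseteq> set xs"
    using ys set_stack_sort[of xs] by auto
  have less: "\<forall>z \<in> set ys. z < Max (set xs)"
    using d sub by (auto simp: order_less_le)
  have "(stack_sort ^^ length xs) xs = (stack_sort ^^ k) (stack_sort xs)"
    by (simp add: Suc.hyps(2)[symmetric] funpow_swap1)
  also have "\<dots> = (stack_sort ^^ k) ys @ [Max (set xs)]"
    using stack_sort_iter_snoc[OF less] ys by simp
  finally show ?case
    using Suc.hyps(1)[of ys] len d less by (simp add: sorted_wrt_append)
qed simp

lemma stack_sort_iter_sc_sorted:
  "distinct xs \<Longrightarrow> sorted_wrt (<) ((stack_sort ^^ sc xs) xs)"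
  unfolding sc_def by (rule LeastI) (rule stack_sort_iter_length_sorted)


section \<open>Suffix maxima and blocks\<close>

fun split_blocks :: "'a list \<Rightarrow> 'a list \<Rightarrow> 'a list list" where
  "split_blocks [] xs = []"
| "split_blocks (c # cs) xs =
     takeWhile (\<lambda>y. y \<noteq> c) xs # split_blocks cs (tl (dropWhile (\<lambda>y. y \<noteq> c) xs))"

text \<open>All blocks in one list, indexed from 0, so that each split at a maximum peels off one
  block. \<open>block_eq_maxima_blocks\<close> relates this to the 1-based
  \<open>block\<close>.\<close>

definition maxima_blocks :: "'a::linorder list \<Rightarrow> 'a list list" where
  "maxima_blocks xs = split_blocks (suffix_maxima xs) xs"

lemma length_split_blocks [simp]: "length (split_blocks cs xs) = length cs"
  by (induction cs xs rule: split_blocks.induct) auto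

lemma length_maxima_blocks [simp]: "length (maxima_blocks xs) = length (suffix_maxima xs)"
  by (simp add: maxima_blocks_def)

lemma suffix_maxima_Nil [simp]: "suffix_maxima [] = []"
  by (simp add: suffix_maxima.simps)

lemma maxima_blocks_Nil [simp]: "maxima_blocks [] = []"
  by (simp add: maxima_blocks_def)

lemma takeWhile_dropWhile_neq:
  assumes "c \<notin> set l"
  shows "takeWhile (\<lambda>y. y \<noteq> c) (l @ c # r) = l"
    and "dropWhile (\<lambda>y. y \<noteq> c) (l @ c # r) = c # r"
  using assms by (induction l) auto

lemma suffix_maxima_split:
  assumes "\<forall>z \<in> set l \<union> set r. z < m"
  shows "suffix_maxima (l @ m # r) = m # suffix_maxima r"
    and "maxima_blocks (l @ m # r) = l # maxima_blocks r"
proof -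
  have M: "Max (set (l @ m # r)) = m"
    using assms by (intro Max_eqI) (auto simp: less_imp_le)
  have ml: "m \<notin> set l" using assms by auto
  show *: "suffix_maxima (l @ m # r) = m # suffix_maxima r"
    by (subst suffix_maxima.simps, unfold M)
       (simp add: takeWhile_dropWhile_neq[OF ml])
  show "maxima_blocks (l @ m # r) = l # maxima_blocks r"
    unfolding maxima_blocks_def * by (simp add: takeWhile_dropWhile_neq[OF ml])
qed

text \<open>Follows the recursion of \<open>suffix_maxima\<close>, which continues only to the right
  of the maximum; hence the induction hypothesis concerns \<open>r\<close> alone.\<close>

lemma distinct_max_induct [consumes 1, case_names Nil split]:
  assumes "distinct xs"
    and "P []"
    and "\<And>l m r. distinct (l @ m # r) \<Longrightarrow> \<forall>z \<in> set l \<union> set r. z < m \<Longrightarrow> P r \<Longrightarrow> P (l @ m # r)"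
  shows "P (xs :: 'a::linorder list)"
  using assms(1)
proof (induction xs rule: length_induct)
  case (1 xs)
  show ?case
  proof (cases "xs = []")
    case False
    obtain l m r where lr: "xs = l @ m # r" "\<forall>z \<in> set l \<union> set r. z < m"
      using split_at_Max[OF 1(2) False] by metis
    then have "P r" using 1 by auto
    then show ?thesis using assms(3) lr 1(2) by simp
  qed (simp add: assms(2))
qed

lemma set_suffix_maxima_subset:
  "distinct xs \<Longrightarrow> set (suffix_maxima xs) \<subseteq> set xs"
  by (induction rule: distinct_max_induct) (auto simp: suffix_maxima_split)

lemma suffix_maxima_decreasing:
  "distinct xs \<Longrightarrow> sorted_wrt (>) (suffix_maxima xs)"
proof (induction rule: distinct_max_induct)
  case (split l m r)
  then show ?case
    using set_suffix_maxima_subset[of r] by (auto simp: suffix_maxima_split)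
qed simp

lemma distinct_suffix_maxima: "distinct xs \<Longrightarrow> distinct (suffix_maxima xs)"
  using suffix_maxima_decreasing[of xs] strict_sorted_iff[of "rev (suffix_maxima xs)"]
  by (simp add: sorted_wrt_rev)

lemma suffix_maxima_greater_later:
  "distinct (u @ x # v) \<Longrightarrow> x \<in> set (suffix_maxima (u @ x # v)) \<Longrightarrow> z \<in> set v \<Longrightarrow> z < x"
proof (induction "u @ x # v" arbitrary: u rule: distinct_max_induct)
  case (split l m r)
  \<comment> \<open>The entry \<open>x\<close> lies to the right of the maximum \<open>m\<close>, is
    \<open>m\<close> itself, or lies to its left. The last case contradicts distinctness, since all
    suffix maxima lie in \<open>m # r\<close>.\<close>
  consider us where "u = l @ m # us" "r = us @ x # v" | "u = l" "x = m" "v = r"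
    | us where "l = u @ x # us" "v = us @ m # r"
    using split.hyps(4) by (auto simp: append_eq_append_conv2 append_eq_Cons_conv Cons_eq_append_conv)
  then show ?case
  proof cases
    case 1
    have "x \<noteq> m" using 1 split.hyps(1) by auto
    then have "x \<in> set (suffix_maxima r)"
      using split.prems(1) split.hyps(2) split.hyps(4)[symmetric] by (auto simp: suffix_maxima_split)
    then show ?thesis using split.hyps(3) 1 split.prems by auto
  next
    case 2
    then show ?thesis using split.hyps(2) split.prems(2) by blast
  next
    case 3
    have "x \<in> set (m # suffix_maxima r)"
      using split.prems(1) split.hyps(2) split.hyps(4)[symmetric] by (simp add: suffix_maxima_split)
    moreover have "distinct r" using split.hyps(1) by simp
    ultimately have "x \<in> set (m # r)" using set_suffix_maxima_subset by auto
    then show ?thesis using 3 split.hyps(1) by auto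
  qed
qed simp

text \<open>Nothing follows the last suffix maximum, so no entry is lost after the last
  block.\<close>

lemma set_concat_maxima_blocks:
  "distinct xs \<Longrightarrow> set (concat (maxima_blocks xs)) = set xs - set (suffix_maxima xs)"
proof (induction rule: distinct_max_induct)
  case (split l m r)
  then show ?case
    using set_suffix_maxima_subset[of r] by (auto simp: suffix_maxima_split)
qed simp

lemma distinct_concat_maxima_blocks: "distinct xs \<Longrightarrow> distinct (concat (maxima_blocks xs))"
proof (induction rule: distinct_max_induct)
  case (split l m r)
  then show ?case
    using set_concat_maxima_blocks[of r] by (auto simp: suffix_maxima_split)
qed simp

lemma maxima_block_less:
  "distinct xs \<Longrightarrow> k < length (suffix_maxima xs) \<Longrightarrow> z \<in> set (maxima_blocks xs ! k)
    \<Longrightarrow> z < suffix_maxima xs ! k"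
proof (induction arbitrary: k rule: distinct_max_induct)
  case (split l m r)
  then show ?case by (cases k) (auto simp: suffix_maxima_split)
qed simp

text \<open>Each suffix maximum expels the block before it in sorted order and then remains on the
  stack, since everything after it in \<open>xs\<close> is smaller. The stack thus ends up holding
  the suffix maxima, the last one on top.\<close>

lemma stack_run_maxima_blocks:
  assumes "distinct xs" "\<forall>z \<in> set xs. \<forall>t \<in> set us. z < t"
  shows "stack_run (xs @ ys) us =
    concat (map stack_sort (maxima_blocks xs)) @ stack_run ys (rev (suffix_maxima xs) @ us)"
  using assms
proof (induction arbitrary: us rule: distinct_max_induct)
  case (split l m r)
  have "stack_run ((l @ m # r) @ ys) us = stack_sort l @ stack_run (m # r @ ys) us"
    using stack_run_append_Cons[of l "[]" m us "r @ ys"] split by (simp add: stack_sort_def)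
  also have "stack_run (m # r @ ys) us = stack_run (r @ ys) (m # us)"
    using split by (intro stack_run_push) auto
  also have "\<dots> = concat (map stack_sort (maxima_blocks r))
      @ stack_run ys (rev (suffix_maxima r) @ m # us)"
    using split by (intro split.IH) auto
  finally show ?case
    using split by (simp add: suffix_maxima_split)
qed simp

lemma stack_sort_around_min:
  assumes "distinct xs" "\<forall>z \<in> set xs. a < z" "\<forall>z \<in> set ys. a < z"
  obtains zs where
    "stack_sort (xs @ a # ys) = concat (map stack_sort (maxima_blocks xs)) @ a # zs"
proof -
  let ?st = "rev (suffix_maxima xs)"
  have "stack_sort (xs @ a # ys)
      = concat (map stack_sort (maxima_blocks xs)) @ stack_run (a # ys) ?st"
    using stack_run_maxima_blocks[of xs "[]" "a # ys"] assms by (simp add: stack_sort_def)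
  also have "stack_run (a # ys) ?st = stack_run ys (a # ?st)"
    using set_suffix_maxima_subset assms by (intro stack_run_push) auto
  \<comment> \<open>Either the input has ended or its next entry exceeds \<open>a\<close>; in both
    cases \<open>a\<close> is popped at once, before any suffix maximum below it.\<close>
  also have "\<dots> = a # (case ys of [] \<Rightarrow> stack_run [] ?st | y # ys' \<Rightarrow> stack_run (y # ys') ?st)"
    using assms by (cases ys) auto
  finally show thesis by (rule that)
qed

lemma distinct_concat_index_unique:
  assumes "distinct (concat bs)" "k < length bs" "k' < length bs" "x \<in> set (bs ! k)" "x \<in> set (bs ! k')"
  shows "k = k'"
  using assms
proof (induction bs arbitrary: k k')
  case (Cons b bs)
  then show ?case
    by (cases k; cases k') (auto, (meson disjoint_iff nth_mem UN_I)+)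
qed simp

text \<open>A sorted block ends with its maximum, so any other entry of the block has a larger entry
  after it and cannot be a suffix maximum. All later blocks come after \<open>x\<close> in the
  concatenation, so their entries are below \<open>x\<close>.\<close>

lemma suffix_maximum_of_sorted_blocks:
  assumes "distinct (concat bs)"
    and "x \<in> set (suffix_maxima (concat (map stack_sort bs)))"
    and "k < length bs" "x \<in> set (bs ! k)"
  shows "x = Max (set (bs ! k))"
    and "\<And>k' z. k < k' \<Longrightarrow> k' < length bs \<Longrightarrow> z \<in> set (bs ! k') \<Longrightarrow> z < x"
proof -
  let ?w = "concat (map stack_sort bs)"
  have "mset ?w = mset (concat bs)"
    by (induction bs) auto
  then have dw: "distinct ?w"
    using assms(1) mset_eq_imp_distinct_iff by blast
  \<comment> \<open>The sorted blocks before and after block \<open>k\<close>.\<close>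
  define w1 w2 where "w1 = concat (map stack_sort (take k bs))"
    and "w2 = concat (map stack_sort (drop (Suc k) bs))"
  have w: "?w = w1 @ stack_sort (bs ! k) @ w2"
    using id_take_nth_drop[OF assms(3)] unfolding w1_def w2_def
    by (metis concat.simps(2) concat_append list.simps(9) map_append)
  have ne: "bs ! k \<noteq> []" using assms(4) by auto
  have "distinct (bs ! k)"
    using dw w by simp
  then obtain ys where ys: "stack_sort (bs ! k) = ys @ [Max (set (bs ! k))]"
    using stack_sort_ends_with_Max ne by blast
  show xmax: "x = Max (set (bs ! k))"
  proof (rule ccontr)
    assume "x \<noteq> Max (set (bs ! k))"
    moreover have "x \<in> set (stack_sort (bs ! k))" using assms(4) by simp
    ultimately have "x \<in> set ys" by (simp add: ys)
    then obtain u v where "ys = u @ x # v" by (meson split_list)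
    then have "?w = (w1 @ u) @ x # (v @ Max (set (bs ! k)) # w2)"
      using w ys by simp
    then have "Max (set (bs ! k)) < x"
      using suffix_maxima_greater_later[of "w1 @ u" x "v @ Max (set (bs ! k)) # w2"] dw assms(2)
      by simp
    then show False using assms(4) by (simp add: leD)
  qed
  fix k' z assume k': "k < k'" "k' < length bs" "z \<in> set (bs ! k')"
  have "bs ! k' \<in> set (drop (Suc k) bs)"
    using k' by (auto simp: in_set_conv_nth intro!: exI[of _ "k' - Suc k"])
  then have "z \<in> set w2" using k'(3) unfolding w2_def by auto
  moreover have "?w = (w1 @ ys) @ x # w2"
    using w ys xmax by simp
  ultimately show "z < x"
    using suffix_maxima_greater_later[of "w1 @ ys" x w2] dw assms(2) by simp
qed

text \<open>The tail \<open>ys\<close> is present because \<open>block\<close> cuts from the whole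
  iterate, including 0 and what follows it, whereas \<open>maxima_blocks\<close> is applied only to
  the part left of 0.\<close>

lemma maxima_blocks_nth:
  assumes "distinct (xs @ ys)" "k < length (suffix_maxima xs)"
  shows "maxima_blocks xs ! k =
    (if k = 0 then takeWhile (\<lambda>y. y \<noteq> suffix_maxima xs ! 0) (xs @ ys)
     else takeWhile (\<lambda>y. y \<noteq> suffix_maxima xs ! k)
       (tl (dropWhile (\<lambda>y. y \<noteq> suffix_maxima xs ! (k - 1)) (xs @ ys))))"
proof -
  have "distinct xs" using assms(1) by simp
  then show ?thesis using assms
  proof (induction arbitrary: k rule: distinct_max_induct)
    case (split l m r)
    have ml: "m \<notin> set l" using split.hyps by auto
    note split_simps = suffix_maxima_split[OF split.hyps(2)] takeWhile_dropWhile_neq[OF ml]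
    show ?case
    proof (cases k)
      case 0
      then show ?thesis using split_simps by simp
    next
      case (Suc k')
      have k': "k' < length (suffix_maxima r)"
        using split.prems(2) Suc by (simp add: split_simps)
      have dr: "distinct (r @ ys)" using split.prems(1) by simp
      note IH = split.IH[OF dr k']
      show ?thesis
      proof (cases k')
        case 0
        then show ?thesis using Suc IH by (simp add: split_simps)
      next
        case (Suc k'')
        let ?c = "suffix_maxima r ! k''"
        have "?c \<in> set r"
          using k' Suc set_suffix_maxima_subset[of r] nth_mem[of k'' "suffix_maxima r"] dr by auto
        \<comment> \<open>The preceding separator lies in \<open>r\<close>, so the search for it
          runs past \<open>l\<close> and \<open>m\<close> without stopping.\<close>
        then have "?c \<notin> set (l @ [m])" using split.hyps(1) by auto
        then have "dropWhile (\<lambda>y. y \<noteq> ?c) ((l @ [m]) @ (r @ ys)) = dropWhile (\<lambda>y. y \<noteq> ?c) (r @ ys)"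
          by (intro dropWhile_append2) auto
        then show ?thesis using \<open>k = Suc k'\<close> Suc IH by (simp add: split_simps)
      qed
    qed
  qed simp
qed


section \<open>Columns and rows of the tableau\<close>

definition left_part :: "nat list \<Rightarrow> nat \<Rightarrow> nat list" where
  "left_part \<pi> i = takeWhile (\<lambda>y. y \<noteq> 0) (sigma \<pi> i)"

lemma C_seq_left_part: "C_seq \<pi> i = suffix_maxima (left_part \<pi> i)"
  by (simp add: C_seq_def left_part_def)

context
  fixes n :: nat and \<pi> :: "nat list"
  assumes pi: "\<pi> \<in> S' n"
begin

lemma distinct_sigma: "distinct (sigma \<pi> i)"
  using pi by (simp add: S'_def sigma_def permutations_of_set_def)

lemma set_sigma: "set (sigma \<pi> i) = {0..n}"
  using pi by (simp add: S'_def sigma_def permutations_of_set_def)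

lemma sigma_split:
  obtains ys where "sigma \<pi> i = left_part \<pi> i @ 0 # ys"
proof -
  have "0 \<in> set (sigma \<pi> i)" by (simp add: set_sigma)
  then obtain l r where lr: "sigma \<pi> i = l @ 0 # r" by (meson split_list)
  then have "0 \<notin> set l" using distinct_sigma[of i] by auto
  then have "left_part \<pi> i = l"
    unfolding left_part_def lr by (rule takeWhile_dropWhile_neq)
  with lr show thesis using that by blast
qed

lemma distinct_left_part: "distinct (left_part \<pi> i)"
  by (simp add: left_part_def distinct_sigma)

lemma zero_less_left_part: "z \<in> set (left_part \<pi> i) \<Longrightarrow> 0 < z"
  by (auto simp: left_part_def dest: set_takeWhileD)

lemma set_left_part_1: "set (left_part \<pi> 1) = {1..n}"
proof -
  have "\<pi> \<noteq> []" "last \<pi> = 0" "distinct \<pi>" "set \<pi> = {0..n}"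
    using pi by (auto simp: S'_def permutations_of_set_def)
  then obtain l where l: "\<pi> = l @ [0]" by (metis append_butlast_last_id)
  then have "0 \<notin> set l" using \<open>distinct \<pi>\<close> by simp
  then have "left_part \<pi> 1 = l"
    using takeWhile_dropWhile_neq(1)[of 0 l "[]"] unfolding left_part_def sigma_def l by simp
  moreover have "set l = {0..n} - {0}"
    using \<open>set \<pi> = {0..n}\<close> \<open>0 \<notin> set l\<close> l by auto
  moreover have "{0..n} - {0} = {1..n}" by auto
  ultimately show ?thesis by simp
qed

text \<open>Since 0 is the minimum of the iterate, \<open>stack_sort_around_min\<close> applies. The
  index starts at 1 because truncated subtraction makes \<open>sigma \<pi> 0\<close> equal to
  \<open>sigma \<pi> 1\<close>.\<close>

lemma left_part_Suc:
  assumes "1 \<le> i"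
  shows "left_part \<pi> (Suc i) = concat (map stack_sort (maxima_blocks (left_part \<pi> i)))"
proof -
  obtain ys where ys: "sigma \<pi> i = left_part \<pi> i @ 0 # ys"
    by (rule sigma_split)
  have "distinct (left_part \<pi> i @ 0 # ys)"
    using distinct_sigma[of i] ys by simp
  then have "0 \<notin> set ys" by simp
  then have "\<forall>z \<in> set ys. 0 < z" by (metis gr0I)
  then obtain zs where zs: "stack_sort (left_part \<pi> i @ 0 # ys) =
      concat (map stack_sort (maxima_blocks (left_part \<pi> i))) @ 0 # zs"
    using stack_sort_around_min[OF distinct_left_part] zero_less_left_part by blast
  have "sigma \<pi> (Suc i) = stack_sort (sigma \<pi> i)"
    using assms by (cases i) (auto simp: sigma_def)
  moreover have "0 \<notin> set (concat (map stack_sort (maxima_blocks (left_part \<pi> i))))"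
    using set_concat_maxima_blocks[OF distinct_left_part, of i] zero_less_left_part[of 0 i] by auto
  ultimately show ?thesis
    unfolding left_part_def[of \<pi> "Suc i"] using zs ys takeWhile_dropWhile_neq(1) by metis
qed

lemma set_left_part_Suc:
  "1 \<le> i \<Longrightarrow> set (left_part \<pi> (Suc i)) = set (left_part \<pi> i) - set (C_seq \<pi> i)"
  using set_concat_maxima_blocks[OF distinct_left_part, of i]
  by (simp add: left_part_Suc C_seq_left_part)

lemma set_C_seq_subset: "set (C_seq \<pi> i) \<subseteq> set (left_part \<pi> i)"
  by (simp add: C_seq_left_part set_suffix_maxima_subset distinct_left_part)

section \<open>The columns partition the entries\<close>

lemma left_part_antimono:
  "1 \<le> i \<Longrightarrow> i \<le> j \<Longrightarrow> set (left_part \<pi> j) \<subseteq> set (left_part \<pi> i)"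
proof (induction j rule: nat_induct)
  case (Suc j)
  then show ?case by (cases "i = Suc j") (auto simp: set_left_part_Suc)
qed simp

lemma C_seq_subset: "1 \<le> i \<Longrightarrow> set (C_seq \<pi> i) \<subseteq> {1..n}"
  using set_C_seq_subset[of i] left_part_antimono[of 1 i] set_left_part_1 by auto

text \<open>Index \<open>Suc (sc \<pi>)\<close> is the iterate after \<open>sc \<pi>\<close> passes;
  it is increasing, so nothing can precede its minimum 0.\<close>

lemma left_part_after_sc: "left_part \<pi> (Suc (sc \<pi>)) = []"
proof -
  have "distinct \<pi>" using distinct_sigma[of 1] by (simp add: sigma_def)
  then have sorted: "sorted_wrt (<) (sigma \<pi> (Suc (sc \<pi>)))"
    using stack_sort_iter_sc_sorted by (simp add: sigma_def)
  obtain ys where "sigma \<pi> (Suc (sc \<pi>)) = left_part \<pi> (Suc (sc \<pi>)) @ 0 # ys"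
    by (rule sigma_split)
  with sorted show ?thesis
    by (cases "left_part \<pi> (Suc (sc \<pi>))") auto
qed

text \<open>Once an entry is a suffix maximum, it is absent from the left parts of all later
  iterates.\<close>

lemma C_seq_column_unique:
  assumes "1 \<le> i" "1 \<le> i'" "x \<in> set (C_seq \<pi> i)" "x \<in> set (C_seq \<pi> i')"
  shows "i = i'"
proof -
  have False if "1 \<le> i" "i < i'" "x \<in> set (C_seq \<pi> i)" "x \<in> set (C_seq \<pi> i')" for i i'
    using that left_part_antimono[of "Suc i" i'] set_left_part_Suc[of i] set_C_seq_subset[of i']
    by auto
  then show ?thesis using assms by (metis linorder_neqE_nat)
qed

text \<open>An entry that belonged to no column would survive in every left part up to the empty one
  after \<open>sc \<pi>\<close> passes.\<close>

lemma C_seq_column_exists: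
  assumes "x \<in> {1..n}"
  obtains i where "i \<in> {1..sc \<pi>}" "x \<in> set (C_seq \<pi> i)"
proof (rule ccontr)
  assume "\<not> thesis"
  then have none: "\<forall>i \<in> {1..sc \<pi>}. x \<notin> set (C_seq \<pi> i)" using that by blast
  have "k \<le> sc \<pi> \<Longrightarrow> x \<in> set (left_part \<pi> (Suc k))" for k
  proof (induction k)
    case 0
    then show ?case using set_left_part_1 assms by simp
  next
    case (Suc k)
    then show ?case using none set_left_part_Suc[of "Suc k"] by simp
  qed
  from this[of "sc \<pi>"] show False by (simp add: left_part_after_sc)
qed

lemma col_colpos_eqI:
  assumes "1 \<le> i" "i \<le> sc \<pi>" "k < length (C_seq \<pi> i)"
  shows "col_colpos \<pi> (C_seq \<pi> i ! k) = (i, Suc k)"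
  unfolding col_colpos_def
proof (rule the_equality)
  show "case (i, Suc k) of (i', j) \<Rightarrow> i' \<in> {1..sc \<pi>} \<and> j \<in> {1..length (C_seq \<pi> i')}
      \<and> C_seq \<pi> i ! k = c_entry \<pi> i' j"
    using assms by (simp add: c_entry_def)
next
  fix p assume p: "case p of (i', j) \<Rightarrow> i' \<in> {1..sc \<pi>} \<and> j \<in> {1..length (C_seq \<pi> i')}
      \<and> C_seq \<pi> i ! k = c_entry \<pi> i' j"
  obtain i' j where ij: "p = (i', j)" by force
  have *: "1 \<le> i'" "1 \<le> j" "j - 1 < length (C_seq \<pi> i')" "C_seq \<pi> i ! k = C_seq \<pi> i' ! (j - 1)"
    using p by (auto simp: ij c_entry_def)
  have "i = i'"
    using C_seq_column_unique[OF assms(1) *(1), of "C_seq \<pi> i ! k"] * assms by (metis nth_mem)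
  moreover have "distinct (C_seq \<pi> i)"
    by (simp add: C_seq_left_part distinct_suffix_maxima distinct_left_part)
  ultimately have "k = j - 1"
    using * assms(3) by (simp add: nth_eq_iff_index_eq)
  then show "p = (i, Suc k)" using ij \<open>i = i'\<close> *(2) by simp
qed

lemma in_C_seq_col:
  assumes "x \<in> {1..n}"
  shows "1 \<le> col \<pi> x" "col \<pi> x \<le> sc \<pi>" "1 \<le> colpos \<pi> x"
    "colpos \<pi> x - 1 < length (C_seq \<pi> (col \<pi> x))"
    "x = C_seq \<pi> (col \<pi> x) ! (colpos \<pi> x - 1)"
proof -
  obtain i where i: "i \<in> {1..sc \<pi>}" "x \<in> set (C_seq \<pi> i)"
    using C_seq_column_exists assms by blast
  then obtain k where k: "k < length (C_seq \<pi> i)" "x = C_seq \<pi> i ! k"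
    by (metis in_set_conv_nth)
  then have "col \<pi> x = i" "colpos \<pi> x = Suc k"
    using col_colpos_eqI[of i k] i by (auto simp: col_def colpos_def)
  with i k show "1 \<le> col \<pi> x" "col \<pi> x \<le> sc \<pi>" "1 \<le> colpos \<pi> x"
    "colpos \<pi> x - 1 < length (C_seq \<pi> (col \<pi> x))"
    "x = C_seq \<pi> (col \<pi> x) ! (colpos \<pi> x - 1)" by auto
qed

section \<open>Blocks and the map \<open>leftof\<close>\<close>

lemma C_seq_nth_less:
  "k < k' \<Longrightarrow> k' < length (C_seq \<pi> i) \<Longrightarrow> C_seq \<pi> i ! k' < C_seq \<pi> i ! k"
  using suffix_maxima_decreasing[OF distinct_left_part, of i]
  by (simp add: C_seq_left_part sorted_wrt_iff_nth_less)

lemma block_eq_maxima_blocks: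
  assumes "k < length (C_seq \<pi> i)"
  shows "block \<pi> i (Suc k) = maxima_blocks (left_part \<pi> i) ! k"
proof -
  obtain ys where ys: "sigma \<pi> i = left_part \<pi> i @ 0 # ys"
    by (rule sigma_split)
  have "distinct (left_part \<pi> i @ 0 # ys)"
    using distinct_sigma[of i] ys by simp
  from maxima_blocks_nth[OF this, of k] assms show ?thesis
    by (simp add: block_def c_entry_def C_seq_left_part ys)
qed

text \<open>The left part of iterate \<open>Suc i\<close> consists of the sorted blocks of iterate
  \<open>i\<close>, so \<open>x\<close> comes from one of them. There \<open>x\<close> is the block
  maximum, and disjointness of the blocks makes the index in the definite description
  unique.\<close>

lemma leftof_block:
  assumes x: "x \<in> {1..n}" and c: "col \<pi> x = Suc i" "1 \<le> i"
  obtains k where "k < length (C_seq \<pi> i)" "x \<in> set (maxima_blocks (left_part \<pi> i) ! k)"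
    "leftof \<pi> x = C_seq \<pi> i ! k"
proof -
  let ?bs = "maxima_blocks (left_part \<pi> i)"
  have xC: "x \<in> set (C_seq \<pi> (Suc i))"
    using in_C_seq_col(4,5)[OF x] c by (metis nth_mem)
  have db: "distinct (concat ?bs)"
    by (simp add: distinct_concat_maxima_blocks distinct_left_part)
  have xs: "x \<in> set (suffix_maxima (concat (map stack_sort ?bs)))"
    using xC left_part_Suc[OF c(2)] by (simp add: C_seq_left_part)
  have "x \<in> set (concat ?bs)"
    using xC set_C_seq_subset[of "Suc i"] left_part_Suc[OF c(2)] by auto
  then obtain k where k: "k < length ?bs" "x \<in> set (?bs ! k)"
    by (metis UN_E in_set_conv_nth set_concat)
  then have kC: "k < length (C_seq \<pi> i)" by (simp add: C_seq_left_part)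
  have "(THE j. j \<in> {1..length (C_seq \<pi> i)} \<and> block \<pi> i j \<noteq> [] \<and> x = Max (set (block \<pi> i j))) = Suc k"
  proof (rule the_equality)
    show "Suc k \<in> {1..length (C_seq \<pi> i)} \<and> block \<pi> i (Suc k) \<noteq> []
        \<and> x = Max (set (block \<pi> i (Suc k)))"
      using kC k suffix_maximum_of_sorted_blocks(1)[OF db xs k]
      by (auto simp: block_eq_maxima_blocks)
  next
    fix j assume j: "j \<in> {1..length (C_seq \<pi> i)} \<and> block \<pi> i j \<noteq> [] \<and> x = Max (set (block \<pi> i j))"
    then obtain k' where k': "j = Suc k'" "k' < length (C_seq \<pi> i)" by (cases j) auto
    \<comment> \<open>Nonemptiness of the block ensures that its \<open>Max\<close> is one of its
      entries.\<close>
    then have "x \<in> set (?bs ! k')"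
      using j by (metis Max_in List.finite_set set_empty block_eq_maxima_blocks)
    then have "k' = k"
      using distinct_concat_index_unique[OF db, of k' k] k k' by (simp add: C_seq_left_part)
    then show "j = Suc k" using k' by simp
  qed
  then have "leftof \<pi> x = C_seq \<pi> i ! k"
    by (simp add: leftof_def c c_entry_def)
  with kC k(2) show thesis using that by blast
qed

lemma leftof_properties:
  assumes x: "x \<in> {1..n}" and c: "col \<pi> x = Suc i" "1 \<le> i"
  shows "x < leftof \<pi> x" "leftof \<pi> x \<in> {1..n}" "col \<pi> (leftof \<pi> x) = i"
    "row \<pi> (leftof \<pi> x) = row \<pi> x"
proof -
  obtain k where k: "k < length (C_seq \<pi> i)" "x \<in> set (maxima_blocks (left_part \<pi> i) ! k)"
    "leftof \<pi> x = C_seq \<pi> i ! k"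
    using leftof_block assms by blast
  show "x < leftof \<pi> x"
    using maxima_block_less[OF distinct_left_part] k by (simp add: C_seq_left_part)
  show "leftof \<pi> x \<in> {1..n}"
    using C_seq_subset[OF c(2)] k by (metis nth_mem subsetD)
  have "i \<le> sc \<pi>" using in_C_seq_col(2)[OF x] c by simp
  then show "col \<pi> (leftof \<pi> x) = i"
    using col_colpos_eqI[OF c(2) _ k(1)] k(3) by (simp add: col_def)
  show "row \<pi> (leftof \<pi> x) = row \<pi> x"
    using c by (subst (2) row.simps) simp
qed

text \<open>As \<open>x\<close> is the maximum of its block and exceeds all later blocks, the larger
  \<open>y\<close> must come from an earlier block, whose suffix maximum is larger.\<close>

lemma leftof_strict_mono:
  assumes "x \<in> {1..n}" "col \<pi> x = Suc i" "y \<in> {1..n}" "col \<pi> y = Suc i" "1 \<le> i" "x < y"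
  shows "leftof \<pi> x < leftof \<pi> y"
proof -
  let ?bs = "maxima_blocks (left_part \<pi> i)"
  obtain k where k: "k < length (C_seq \<pi> i)" "x \<in> set (?bs ! k)" "leftof \<pi> x = C_seq \<pi> i ! k"
    using leftof_block assms by blast
  obtain l where l: "l < length (C_seq \<pi> i)" "y \<in> set (?bs ! l)" "leftof \<pi> y = C_seq \<pi> i ! l"
    using leftof_block assms by blast
  have db: "distinct (concat ?bs)"
    by (simp add: distinct_concat_maxima_blocks distinct_left_part)
  have len: "length ?bs = length (C_seq \<pi> i)" by (simp add: C_seq_left_part)
  have "x \<in> set (C_seq \<pi> (Suc i))"
    using in_C_seq_col(4,5)[OF assms(1)] assms(2) by (metis nth_mem)
  then have xs: "x \<in> set (suffix_maxima (concat (map stack_sort ?bs)))"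
    using left_part_Suc[OF assms(5)] by (simp add: C_seq_left_part)
  note max = suffix_maximum_of_sorted_blocks[OF db xs _ k(2)]
  have "l \<noteq> k"
    using max(1) k(1) l(2) len assms(6) by (metis List.finite_set Max_ge leD)
  moreover have "\<not> k < l"
    using max(2)[of l y] k(1) l len assms(6) by auto
  ultimately show ?thesis
    using C_seq_nth_less[of l k i] k l by simp
qed

text \<open>In column 1 the row is the position in the decreasing sequence of suffix maxima. Later
  columns reduce to the previous one, since \<open>leftof\<close> preserves rows and strict
  order.\<close>

lemma row_strict_antimono_column:
  assumes "x \<in> {1..n}" "y \<in> {1..n}" "col \<pi> x = i" "col \<pi> y = i" "x < y"
  shows "row \<pi> y < row \<pi> x"
  using assms
proof (induction i arbitrary: x y)
  case 0
  then show ?case using in_C_seq_col(1)[of x] by simp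
next
  case (Suc i)
  show ?case
  proof (cases "i = 0")
    case True
    note cx = in_C_seq_col[OF Suc.prems(1)] and cy = in_C_seq_col[OF Suc.prems(2)]
    have "colpos \<pi> y - 1 < colpos \<pi> x - 1"
    proof (rule ccontr)
      assume "\<not> ?thesis"
      then have "y \<le> x"
        using C_seq_nth_less[of "colpos \<pi> x - 1" "colpos \<pi> y - 1" "Suc i"] cx(5) cy(4,5) Suc.prems
        by (metis less_imp_le linorder_neqE_nat order_refl)
      then show False using Suc.prems by simp
    qed
    moreover have "row \<pi> x = colpos \<pi> x" "row \<pi> y = colpos \<pi> y"
      using Suc.prems True by (subst row.simps, simp)+
    ultimately show ?thesis by simp
  next
    case False
    then have i: "1 \<le> i" by simp
    note lx = leftof_properties[OF Suc.prems(1,3) i] and ly = leftof_properties[OF Suc.prems(2,4) i]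
    have "leftof \<pi> x < leftof \<pi> y"
      using leftof_strict_mono Suc.prems i by blast
    then show ?thesis
      using Suc.IH[OF lx(2) ly(2) lx(3) ly(3)] lx(4) ly(4) by simp
  qed
qed

lemma tableau_decreasing:
  assumes "x \<in> {1..n}" "y \<in> {1..n}" "col \<pi> x \<le> col \<pi> y" "row \<pi> x \<le> row \<pi> y"
  shows "y \<le> x"
  using assms(2-4)
proof (induction "col \<pi> y" arbitrary: y)
  case 0
  then show ?case using in_C_seq_col(1)[of y] by simp
next
  case (Suc i)
  show ?case
  proof (cases "col \<pi> x = Suc i")
    case True
    then show ?thesis
      using row_strict_antimono_column[of x y] assms(1) Suc by fastforce
  next
    case False
    then have le: "col \<pi> x \<le> i" using Suc by simp
    then have i: "1 \<le> i" using in_C_seq_col(1)[OF assms(1)] by simp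
    \<comment> \<open>Replacing \<open>y\<close> by \<open>leftof \<pi> y\<close> keeps the row,
      moves one column left and increases the value, so a bound on the new entry also bounds
      \<open>y\<close>.\<close>
    note ly = leftof_properties[OF Suc.prems(1) Suc.hyps(2)[symmetric] i]
    have "leftof \<pi> y \<le> x"
      using Suc.hyps(1)[OF ly(3)[symmetric] ly(2)] le ly Suc.prems by simp
    then show ?thesis using ly(1) by simp
  qed
qed

end

theorem theorem3p16:
  fixes n :: nat and \<pi> :: "nat list" and x y :: nat
  assumes "\<pi> \<in> S' n"
    and "x \<in> {1..n}" and "y \<in> {1..n}"
    and "tableau \<pi> x \<ge>\<^sub>D tableau \<pi> y"
  shows "x \<ge> y"
  using tableau_decreasing[OF assms(1-3)] assms(4)
  by (simp add: tableau_def diagram_ge_def)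

end
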